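(* Let $d\ge 2$, $t\ge 2$, let $X=\{x_1,\ldots,x_N\}\subset\mathbb S^{d-1}$ be a spherical $t$-design, let $P=P_X$ be its Steiner-normalized Minkowski polytope, and put $h_i=h_P(x_i)>0$ and $v_i=x_i/h_i$ for $1\le i\le N$. Then for every integer $0\le m\le t$ and every homogeneous polynomial $H_m$ of degree $m$ on $\mathbb R^d$, $$\frac1N\sum_{i=1}^N h_i^m H_m(v_i)=\int_{\mathbb S^{d-1}}H_m(u)\,d\sigma(u).$$ Equivalently, in the $m$th symmetric tensor power of $\mathbb R^d$, $$\frac1N\sum_{i=1}^N h_i^m v_i^{\otimes m}=M_{d,m}:=\int_{\mathbb S^{d-1}}u^{\otimes m}\,d\sigma(u).$$
   Context: $\sigma$ is the normalized (probability) surface measure on the unit sphere $\mathbb S^{d-1}\subset\mathbb R^d$, and $\omega_{d-1}$ is the total $(d-1)$-area of $\mathbb S^{d-1}$. A finite set $X=\{x_1,\ldots,x_N\}\subset\mathbb S^{d-1}$ of $N$ distinct points is a spherical $t$-design if $\frac1N\sum_i p(x_i)=\int p\,d\sigma$ for every polynomial $p$ of total degree at most $t$. For $t\ge2$, the Minkowski polytope $P_X\subset\mathbb R^d$ is the full-dimensional convex polytope, unique up to translation (Minkowski's theorem), whose surface area measure is $\frac{\omega_{d-1}}N\sum_i\delta_{x_i}$: it has exactly $N$ facets, with outer unit normals $x_1,\ldots,x_N$, each of $(d-1)$-area $\omega_{d-1}/N$. It is Steiner-normalized: the translate is chosen so that the Steiner point $s(P_X)=d\int_{\mathbb S^{d-1}}h_{P_X}(u)u\,d\sigma(u)$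 is $0$, which implies $0\in\operatorname{int}P_X$. Here $h_P(u)=\max_{y\in P}\langle u,y\rangle$ is the support function. The points $v_i$ are exactly the vertices of the polar body $P_X^\circ=\{z:\langle z,y\rangle\le1\ \forall y\in P_X\}$. *)

theory Defs
  imports "HOL-Analysis.Analysis"
begin

text \<open>
  Hausdorff measure of integer dimension \<open>k\<close>, as an outer measure, scaled so that it agrees with
  \<open>k\<close>-dimensional Lebesgue measure on \<open>k\<close>-dimensional flats. The covering sets are required to be
  bounded because \<^const>\<open>diameter\<close> is unspecified otherwise; the case distinction makes the
  empty set cost nothing also for \<open>k = 0\<close>, where \<open>0 ^ 0 = 1\<close>.
\<close>

definition hausdorff_outer :: "nat \<Rightarrow> 'a::metric_space set \<Rightarrow> ennreal" where
  "hausdorff_outer k A =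
     (SUP \<delta>\<in>{0::real<..}.
        INF C\<in>{C :: nat \<Rightarrow> 'a set. A \<subseteq> (\<Union>i. C i) \<and> (\<forall>i. bounded (C i) \<and> diameter (C i) \<le> \<delta>)}.
          \<Sum>i. if C i = {} then 0
              else ennreal (unit_ball_vol (real k) * (diameter (C i) / 2) ^ k))"

definition hausdorff_measure :: "nat \<Rightarrow> 'a::metric_space measure" where
  "hausdorff_measure k = measure_of UNIV (sets borel) (hausdorff_outer k)"

text \<open>
  The Euclidean space is \<open>real ^ 'n\<close> with \<open>d = CARD('n)\<close>. The normalized surface measure \<open>\<sigma>\<close> is
  represented as a Borel measure on the whole space, concentrated on the sphere.
\<close>

definition sphere_area :: "'n::finite itself \<Rightarrow> ennreal" where
  "sphere_area _ = hausdorff_outer (CARD('n) - 1) (sphere (0 :: real ^ 'n) 1)"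

definition sphere_measure :: "(real ^ 'n::finite) measure" where
  "sphere_measure = uniform_measure (hausdorff_measure (CARD('n) - 1)) (sphere 0 1)"

text \<open>Polynomial functions as linear combinations of monomials with exponent vectors \<open>\<alpha>\<close>.\<close>

definition monomial_fun :: "('n::finite \<Rightarrow> nat) \<Rightarrow> real ^ 'n \<Rightarrow> real" where
  "monomial_fun \<alpha> x = (\<Prod>i\<in>UNIV. (x $ i) ^ \<alpha> i)"

definition poly_of_degree_le :: "nat \<Rightarrow> (real ^ 'n::finite \<Rightarrow> real) \<Rightarrow> bool" where
  "poly_of_degree_le t p \<longleftrightarrow>
     (\<exists>c. p = (\<lambda>x. \<Sum>\<alpha> | (\<Sum>i\<in>UNIV. \<alpha> i) \<le> t. c \<alpha> * monomial_fun \<alpha> x))"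

definition homogeneous_poly :: "nat \<Rightarrow> (real ^ 'n::finite \<Rightarrow> real) \<Rightarrow> bool" where
  "homogeneous_poly m p \<longleftrightarrow>
     (\<exists>c. p = (\<lambda>x. \<Sum>\<alpha> | (\<Sum>i\<in>UNIV. \<alpha> i) = m. c \<alpha> * monomial_fun \<alpha> x))"

definition spherical_design :: "nat \<Rightarrow> (real ^ 'n::finite) set \<Rightarrow> bool" where
  "spherical_design t X \<longleftrightarrow>
     finite X \<and> X \<subseteq> sphere 0 1 \<and>
     (\<forall>p. poly_of_degree_le t p \<longrightarrow>
        1 / real (card X) * (\<Sum>x\<in>X. p x) = (\<integral>u. p u \<partial>sphere_measure))"

definition support_function :: "'a::real_inner set \<Rightarrow> 'a \<Rightarrow> real" where
  "support_function P u = (SUP y\<in>P. u \<bullet> y)"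

definition steiner_point :: "(real ^ 'n::finite) set \<Rightarrow> real ^ 'n" where
  "steiner_point P =
     real CARD('n) *\<^sub>R (\<integral>u. support_function P u *\<^sub>R u \<partial>sphere_measure)"

text \<open>
  Surface area measure: the \<open>(d - 1)\<close>-area of the set of those boundary points that have an outer
  unit normal in \<open>A\<close>.
\<close>

definition surface_area_measure :: "(real ^ 'n::finite) set \<Rightarrow> (real ^ 'n) set \<Rightarrow> ennreal" where
  "surface_area_measure P A =
     hausdorff_outer (CARD('n) - 1)
       {y \<in> frontier P. \<exists>u\<in>A. norm u = 1 \<and> (\<forall>z\<in>P. u \<bullet> z \<le> u \<bullet> y)}"

text \<open>
  \<open>P\<close> is a full-dimensional polytope with surface area measure
  \<open>\<omega>\<^bsub>d-1\<^esub> / N \<cdot> (\<Sum>x\<in>X. \<delta>\<^sub>x)\<close>, where \<open>N = card X\<close>. By Minkowski's theorem this determines \<open>P\<close> up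
  to translation.
\<close>

definition minkowski_polytope :: "(real ^ 'n::finite) set \<Rightarrow> (real ^ 'n) set \<Rightarrow> bool" where
  "minkowski_polytope X P \<longleftrightarrow>
     polytope P \<and> interior P \<noteq> {} \<and>
     (\<forall>A\<in>sets borel. surface_area_measure P A =
        (\<Sum>x\<in>X. sphere_area TYPE('n) / of_nat (card X) * indicator A x))"

definition steiner_normalized_minkowski_polytope ::
    "(real ^ 'n::finite) set \<Rightarrow> (real ^ 'n) set \<Rightarrow> bool" where
  "steiner_normalized_minkowski_polytope X P \<longleftrightarrow> minkowski_polytope X P \<and> steiner_point P = 0"

text \<open>
  A tensor of order \<open>m\<close> on \<open>real ^ 'n\<close> is given by its array of coordinates, indexed by the words of
  length \<open>m\<close> over \<open>'n\<close> and extended by \<open>0\<close> to words of other lengths; it is symmetric if the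
  coordinates are invariant under permuting the index word. Linear combinations and integrals of
  tensors are taken coordinatewise.
\<close>

definition symmetric_tensors :: "nat \<Rightarrow> ('n list \<Rightarrow> real) set" where
  "symmetric_tensors m =
     {T. (\<forall>I. length I \<noteq> m \<longrightarrow> T I = 0) \<and> (\<forall>I J. mset I = mset J \<longrightarrow> T I = T J)}"

definition tensor_power :: "nat \<Rightarrow> real ^ 'n \<Rightarrow> 'n list \<Rightarrow> real" where
  "tensor_power m v I = (if length I = m then prod_list (map (\<lambda>i. v $ i) I) else 0)"

definition moment_tensor :: "nat \<Rightarrow> 'n::finite list \<Rightarrow> real" where
  "moment_tensor m I = (\<integral>u. tensor_power m (u :: real ^ 'n) I \<partial>sphere_measure)"

lemma tensor_power_symmetric: "tensor_power m v \<in> symmetric_tensors m"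
proof -
  have "tensor_power m v I = tensor_power m v J" if "mset I = mset J" for I J
  proof -
    have "prod_mset (mset (map (\<lambda>i. v $ i) I)) = prod_mset (mset (map (\<lambda>i. v $ i) J))"
      using that by (simp only: mset_map)
    then have "prod_list (map (\<lambda>i. v $ i) I) = prod_list (map (\<lambda>i. v $ i) J)"
      by (simp only: prod_mset_prod_list)
    with mset_eq_length[OF that] show ?thesis
      by (simp only: tensor_power_def)
  qed
  moreover have "tensor_power m v I = 0" if "length I \<noteq> m" for I
    using that by (simp only: tensor_power_def if_False)
  ultimately show ?thesis
    unfolding symmetric_tensors_def by blast
qed

end

theory Submission
  imports Defs
begin

text \<open>
  Since \<open>h\<^sub>i ^ m * H (v\<^sub>i) = H (x\<^sub>i)\<close> when \<open>h\<^sub>i > 0\<close>, the identities are the design property applied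
  to \<open>H\<close>; the point is the positivity of \<open>h\<^sub>i\<close>. Let \<open>e\<close> be a unit vector and \<open>u'\<close> the reflection of \<open>u\<close>
  in the hyperplane orthogonal to \<open>e\<close>. Pairing the Steiner point with \<open>e\<close> and symmetrizing gives
  \<open>0 = \<integral>u. (h u - h u') * (u \<bullet> e) \<partial>\<sigma>\<close>. As \<open>u = u' + 2 (u \<bullet> e) e\<close>, sublinearity of \<open>h\<close> bounds the
  integrand by \<open>2 (u \<bullet> e)\<^sup>2 * h e\<close>. If \<open>h e \<le> 0\<close>, the integrand is therefore nonpositive and hence
  zero \<open>\<sigma>\<close>-almost everywhere; but at \<open>u = e\<close> it equals \<open>h e - h (- e)\<close>, which is negative because \<open>P\<close>
  has positive width, and \<open>\<sigma>\<close> charges every neighbourhood of \<open>e\<close>.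

  Only two properties of \<open>\<sigma>\<close> enter: its invariance under isometries, and its total mass, which is
  read off from the design property for the constant polynomial.
\<close>

section \<open>Isometry invariance of the surface measure\<close>

lemma diameter_isometry_image:
  assumes "\<And>x y. dist (f x) (f y) = dist x y"
  shows "diameter (f ` S) = diameter S"
proof -
  have "(\<lambda>(x, y). dist x y) ` (f ` S \<times> f ` S) = (\<lambda>(x, y). dist x y) ` (S \<times> S)"
    using assms by (force simp: image_iff)
  then show ?thesis
    by (simp add: diameter_def)
qed

text \<open>Mapping a cover of \<open>A\<close> by \<open>f\<close> keeps all diameters, so the
  image is covered at the same cost. Orthogonal maps get equality by using this for the map and for
  its inverse.\<close>

lemma hausdorff_outer_isometry_image_le:
  fixes f :: "'a::metric_space \<Rightarrow> 'b::metric_space"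
  assumes iso: "\<And>x y. dist (f x) (f y) = dist x y"
  shows "hausdorff_outer k (f ` A) \<le> hausdorff_outer k A"
proof -
  have bdd: "bounded (f ` S)" if "bounded S" for S
  proof -
    from that obtain x e where "\<forall>y\<in>S. dist x y \<le> e"
      unfolding bounded_def by blast
    then show ?thesis
      unfolding bounded_def using iso by (intro exI[of _ "f x"] exI[of _ e]) auto
  qed
  show ?thesis
    unfolding hausdorff_outer_def
  proof (rule SUP_mono, rule bexI, rule INF_mono)
    fix \<delta> :: real and C :: "nat \<Rightarrow> 'a set"
    assume C: "C \<in> {C. A \<subseteq> (\<Union>i. C i) \<and> (\<forall>i. bounded (C i) \<and> diameter (C i) \<le> \<delta>)}"
    then have "(\<lambda>i. f ` C i) \<in>
        {C. f ` A \<subseteq> (\<Union>i. C i) \<and> (\<forall>i. bounded (C i) \<and> diameter (C i) \<le> \<delta>)}"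
      using bdd by (fastforce simp: diameter_isometry_image[OF iso])
    then show "\<exists>D\<in>{C. f ` A \<subseteq> (\<Union>i. C i) \<and> (\<forall>i. bounded (C i) \<and> diameter (C i) \<le> \<delta>)}.
        (\<Sum>i. if D i = {} then 0
              else ennreal (unit_ball_vol (real k) * (diameter (D i) / 2) ^ k))
        \<le> (\<Sum>i. if C i = {} then 0
              else ennreal (unit_ball_vol (real k) * (diameter (C i) / 2) ^ k))"
      by (rule bexI[rotated]) (simp add: diameter_isometry_image[OF iso] cong: if_cong)
  qed
qed

lemma hausdorff_outer_orthogonal_vimage:
  fixes f :: "'a::euclidean_space \<Rightarrow> 'a"
  assumes "orthogonal_transformation f"
  shows "hausdorff_outer k (f -` A) = hausdorff_outer k A"
proof (rule antisym)
  have inv: "orthogonal_transformation (inv f)" and bij: "bij f"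
    using assms by (auto simp: orthogonal_transformation_inv orthogonal_transformation_bij)
  have dist: "dist (g x) (g y) = dist x y" if "orthogonal_transformation g" for g :: "'a \<Rightarrow> 'a" and x y
    using that by (metis dist_norm linear_diff orthogonal_transformation_linear
        orthogonal_transformation_norm)
  show "hausdorff_outer k (f -` A) \<le> hausdorff_outer k A"
    using hausdorff_outer_isometry_image_le[OF dist[OF inv], where k = k and A = A]
    by (simp add: bij bij_vimage_eq_inv_image)
  show "hausdorff_outer k A \<le> hausdorff_outer k (f -` A)"
    using hausdorff_outer_isometry_image_le[OF dist[OF assms], where k = k and A = "f -` A"]
    by (simp add: bij bij_is_surj surj_image_vimage_eq)
qed

lemma borel_measurable_orthogonal:
  fixes f :: "'a::euclidean_space \<Rightarrow> 'a"
  assumes "orthogonal_transformation f"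
  shows "f \<in> borel_measurable borel"
  using assms by (intro borel_measurable_continuous_onI linear_continuous_on)
    (simp add: linear_conv_bounded_linear[symmetric] orthogonal_transformation_linear)

section \<open>The surface measure under orthogonal maps\<close>

lemma sets_hausdorff_measure [measurable_cong, simp]: "sets (hausdorff_measure k) = sets borel"
  using sets.sigma_sets_eq[of borel] by (simp add: hausdorff_measure_def)

lemma space_hausdorff_measure [simp]: "space (hausdorff_measure k) = UNIV"
  by (simp add: hausdorff_measure_def space_measure_of_conv)

lemma sets_sphere_measure [measurable_cong, simp]: "sets sphere_measure = sets borel"
  by (simp add: sphere_measure_def)

lemma space_sphere_measure [simp]: "space sphere_measure = UNIV"
  by (simp add: sphere_measure_def)

lemma emeasure_hausdorff_measure_orthogonal_vimage:
  fixes f :: "'a::euclidean_space \<Rightarrow> 'a"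
  assumes f: "orthogonal_transformation f" and A: "A \<in> sets borel"
  shows "emeasure (hausdorff_measure k) (f -` A) = emeasure (hausdorff_measure k) A"
proof -
  have "f -` A \<in> sets borel"
    using measurable_sets[OF borel_measurable_orthogonal[OF f] A] by simp
  \<comment> \<open>\<open>measure_of\<close> takes the value 0 everywhere if
    \<open>hausdorff_outer k\<close> is not a measure on the Borel sets. Both sides fall under the
    same case and agree in each.\<close>
  with A show ?thesis
    using sets.sigma_sets_eq[of "borel :: 'a measure"]
    by (simp add: hausdorff_measure_def emeasure_measure_of_conv
        hausdorff_outer_orthogonal_vimage[OF f])
qed

lemma emeasure_sphere_measure:
  fixes A :: "(real ^ 'n::finite) set"
  assumes "A \<in> sets borel"
  shows "emeasure sphere_measure A = emeasure (hausdorff_measure (CARD('n) - 1)) (sphere 0 1 \<inter> A) /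
    emeasure (hausdorff_measure (CARD('n) - 1)) (sphere 0 1 :: (real ^ 'n) set)"
  using assms by (simp add: sphere_measure_def borel_closed)

lemma emeasure_sphere_measure_sphere:
  "emeasure sphere_measure (sphere 0 1 :: (real ^ 'n::finite) set) =
    emeasure sphere_measure (UNIV :: (real ^ 'n) set)"
  by (simp add: emeasure_sphere_measure borel_closed)

lemma emeasure_sphere_measure_orthogonal_vimage:
  fixes f :: "real ^ 'n::finite \<Rightarrow> real ^ 'n"
  assumes f: "orthogonal_transformation f" and A: "A \<in> sets borel"
  shows "emeasure sphere_measure (f -` A) = emeasure sphere_measure A"
proof -
  have "sphere 0 1 \<inter> f -` A = f -` (sphere 0 1 \<inter> A)"
    using orthogonal_transformation_norm[OF f] by auto
  moreover have "f -` A \<in> sets borel"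
    using measurable_sets[OF borel_measurable_orthogonal[OF f] A] by simp
  ultimately show ?thesis
    using A by (simp add: emeasure_sphere_measure borel_closed
        emeasure_hausdorff_measure_orthogonal_vimage[OF f] del: vimage_Int)
qed

lemma distr_sphere_measure_orthogonal:
  fixes f :: "real ^ 'n::finite \<Rightarrow> real ^ 'n"
  assumes "orthogonal_transformation f"
  shows "distr sphere_measure borel f = sphere_measure"
  using borel_measurable_orthogonal[OF assms]
  by (intro measure_eqI)
    (simp_all add: emeasure_distr emeasure_sphere_measure_orthogonal_vimage[OF assms]
      measurable_cong_sets[OF sets_sphere_measure refl])

lemma AE_sphere_measure: "AE u in sphere_measure. norm (u :: real ^ 'n::finite) = 1"
  unfolding sphere_measure_def
  by (rule AE_uniform_measureI) (auto simp: borel_closed)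

section \<open>Reflections and the support of the surface measure\<close>

text \<open>For \<open>w = 0\<close> this is the identity, because \<open>x / 0 = 0\<close>.\<close>

definition reflection :: "'a::real_inner \<Rightarrow> 'a \<Rightarrow> 'a" where
  "reflection w x = x - (2 * (x \<bullet> w) / (w \<bullet> w)) *\<^sub>R w"

lemma orthogonal_transformation_reflection:
  "orthogonal_transformation (reflection (w :: 'a::euclidean_space))"
  unfolding orthogonal_transformation_def
proof (intro conjI allI)
  show "linear (reflection w)"
    by (rule linearI)
      (simp_all add: reflection_def inner_add_left algebra_simps add_divide_distrib)
  fix x y
  show "reflection w x \<bullet> reflection w y = x \<bullet> y"
    by (cases "w = 0")
      (simp_all add: reflection_def inner_diff_left inner_diff_right inner_commute field_simps)
qed

text \<open>Equal norms make \<open>a \<bullet> (a - b)\<close> half the squared length of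
  \<open>a - b\<close>, so for distinct vectors the coefficient in \<open>reflection\<close> is 1.
  Hence reflections act transitively on the unit sphere.\<close>

lemma reflection_swap:
  assumes "norm a = norm b"
  shows "reflection (a - b) a = b"
proof (cases "a = b")
  case False
  have "a \<bullet> a = b \<bullet> b"
    using assms by (simp add: dot_square_norm)
  then have "2 * (a \<bullet> (a - b)) = (a - b) \<bullet> (a - b)"
    by (simp add: inner_diff_left inner_diff_right inner_commute)
  with False have "2 * (a \<bullet> (a - b)) / ((a - b) \<bullet> (a - b)) = 1"
    by simp
  then show ?thesis
    by (simp only: reflection_def) simp
qed (simp add: reflection_def)

text \<open>
  If an open set meeting the sphere were null, finitely many reflected copies of it would cover the
  sphere, which would then be null too.
\<close>

lemma emeasure_sphere_measure_open_pos:
  fixes U :: "(real ^ 'n::finite) set"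
  assumes nz: "emeasure sphere_measure (UNIV :: (real ^ 'n) set) \<noteq> 0"
    and U: "open U" "e \<in> U" and e: "norm e = 1"
  shows "emeasure sphere_measure U \<noteq> 0"
proof
  assume null: "emeasure sphere_measure U = 0"
  let ?V = "\<lambda>b. reflection (b - e) -` U"
  have open_V: "open (?V b)" for b
    using U by (intro open_vimage linear_continuous_on)
      (simp_all add: linear_conv_bounded_linear[symmetric] orthogonal_transformation_linear
        orthogonal_transformation_reflection)
  \<comment> \<open>Each unit vector \<open>b\<close> lies in \<open>?V b\<close>, since
    \<open>reflection (b - e)\<close> sends it to \<open>e\<close>.\<close>
  have "sphere 0 1 \<subseteq> (\<Union>b\<in>sphere 0 1. ?V b)"
    using U e by (auto simp: reflection_swap intro!: bexI)
  then obtain F where F: "F \<subseteq> sphere 0 1" "finite F" "sphere 0 1 \<subseteq> (\<Union>b\<in>F. ?V b)"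
    using compactE_image[OF compact_sphere, of "sphere 0 1" ?V 0 1] open_V by blast
  have "?V b \<in> null_sets sphere_measure" for b
    using null U open_V[of b]
    by (auto simp: null_sets_def borel_open
        emeasure_sphere_measure_orthogonal_vimage[OF orthogonal_transformation_reflection])
  with F(2) have "(\<Union>b\<in>F. ?V b) \<in> null_sets sphere_measure"
    by (intro null_sets_UN') (auto intro: countable_finite)
  with F(3) have "sphere 0 1 \<in> null_sets (sphere_measure :: (real ^ 'n) measure)"
    by (rule null_sets_subset[rotated 2]) (simp add: borel_closed)
  with nz show False
    by (simp add: null_sets_def emeasure_sphere_measure_sphere)
qed

section \<open>The Steiner point is an interior point\<close>

lemma bdd_above_inner_image:
  assumes "bounded P"
  shows "bdd_above ((\<lambda>y. u \<bullet> y) ` P)"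
  using assms by (intro bounded_imp_bdd_above bounded_linear_image bounded_linear_inner_right)

lemma support_function_ge:
  assumes "bounded P" "y \<in> P"
  shows "u \<bullet> y \<le> support_function P u"
  unfolding support_function_def
  using assms by (intro cSUP_upper bdd_above_inner_image)

lemma support_function_add_le:
  assumes "bounded P" "P \<noteq> {}"
  shows "support_function P (u + v) \<le> support_function P u + support_function P v"
  unfolding support_function_def[of P "u + v"]
  using assms by (intro cSUP_least) (auto simp: inner_add_left intro!: add_mono support_function_ge)

lemma support_function_scaleR:
  assumes "bounded P" "P \<noteq> {}" "0 \<le> c"
  shows "support_function P (c *\<^sub>R u) = c * support_function P u"
proof (rule antisym)
  show le: "support_function P (c *\<^sub>R u) \<le> c * support_function P u"
    unfolding support_function_def[of P "c *\<^sub>R u"] using assms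
    by (intro cSUP_least) (auto intro!: mult_left_mono support_function_ge)
  show "c * support_function P u \<le> support_function P (c *\<^sub>R u)"
  proof (cases "c = 0")
    case True
    with \<open>P \<noteq> {}\<close> show ?thesis
      by (simp add: support_function_def)
  next
    case False
    with assms have c: "0 < c" by simp
    have "support_function P u \<le> support_function P (c *\<^sub>R u) / c"
      unfolding support_function_def[of P u] using assms c
      by (intro cSUP_least) (auto simp: field_simps support_function_ge[of P _ "c *\<^sub>R u", simplified])
    with c show ?thesis
      by (simp add: field_simps)
  qed
qed

text \<open>If \<open>P\<close> lies in the ball of radius \<open>B\<close>, Cauchy-Schwarz bounds
  the support function by \<open>B * norm u\<close>, and subadditivity turns this into a Lipschitz
  estimate.\<close>

lemma continuous_on_support_function:
  assumes P: "bounded P" "P \<noteq> {}"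
  shows "continuous_on UNIV (support_function P)"
proof -
  obtain B where B: "0 < B" "\<And>y. y \<in> P \<Longrightarrow> norm y \<le> B"
    using P bounded_pos by blast
  have "support_function P u \<le> B * norm u" for u
    unfolding support_function_def
  proof (rule cSUP_least[OF P(2)])
    fix y assume "y \<in> P"
    then have "norm u * norm y \<le> norm u * B"
      by (intro mult_left_mono B) auto
    with norm_cauchy_schwarz[of u y] show "u \<bullet> y \<le> B * norm u"
      by (simp add: mult.commute)
  qed
  then have "support_function P u - support_function P w \<le> B * norm (u - w)" for u w
    using support_function_add_le[OF P, of w "u - w"] by (smt (verit) diff_add_cancel add.commute)
  then have "\<bar>support_function P u - support_function P w\<bar> \<le> B * norm (u - w)" for u w
    by (smt (verit) norm_minus_commute)
  with B have "B-lipschitz_on UNIV (support_function P)"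
    by (intro lipschitz_onI) (auto simp: dist_norm)
  then show ?thesis
    by (rule lipschitz_on_continuous_on)
qed

text \<open>\<open>P\<close> contains a segment of some length \<open>r > 0\<close> in direction
  \<open>e\<close>, so its width in that direction is at least \<open>r\<close>.\<close>

lemma support_function_width_pos:
  assumes P: "bounded P" "interior P \<noteq> {}" and e: "norm e = 1"
  shows "0 < support_function P e + support_function P (- e)"
proof -
  obtain y r where r: "0 < r" "cball y r \<subseteq> P"
    using P(2) by (metis all_not_in_conv mem_interior_cball)
  have "y \<in> P" "y + r *\<^sub>R e \<in> P"
    using r e by (auto intro!: subsetD[OF r(2)] simp: dist_norm)
  then have "e \<bullet> (y + r *\<^sub>R e) \<le> support_function P e" "- e \<bullet> y \<le> support_function P (- e)"
    by (auto intro: support_function_ge[OF P(1)] simp del: inner_minus_left)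
  moreover have "e \<bullet> e = 1"
    using e by (simp add: dot_square_norm)
  ultimately show ?thesis
    using r(1) by (simp add: inner_add_right)
qed

text \<open>Positive homogeneity needs a nonnegative multiple of \<open>e\<close>, so the sign of
  \<open>u \<bullet> e\<close> decides which of \<open>u\<close> and its mirror image is written as
  the other plus such a multiple. In the negative case, multiplying by \<open>u \<bullet> e\<close>
  reverses the inequality into the same bound.\<close>

lemma support_function_reflection_le:
  assumes P: "bounded P" "P \<noteq> {}" and e: "norm e = 1"
  shows "(support_function P u - support_function P (reflection e u)) * (u \<bullet> e) \<le>
    2 * (u \<bullet> e)\<^sup>2 * support_function P e"
proof -
  let ?h = "support_function P" and ?c = "u \<bullet> e"
  have refl: "reflection e u = u - (2 * ?c) *\<^sub>R e"
    using e by (simp add: reflection_def dot_square_norm)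
  show ?thesis
  proof (cases "0 \<le> ?c")
    case True
    have "?h u \<le> ?h (reflection e u) + ?h ((2 * ?c) *\<^sub>R e)"
      using support_function_add_le[OF P, of "reflection e u" "(2 * ?c) *\<^sub>R e"] by (simp add: refl)
    also have "?h ((2 * ?c) *\<^sub>R e) = 2 * ?c * ?h e"
      using True by (intro support_function_scaleR[OF P]) simp
    finally have "(?h u - ?h (reflection e u)) * ?c \<le> (2 * ?c * ?h e) * ?c"
      using True by (intro mult_right_mono) auto
    then show ?thesis
      by (simp add: power2_eq_square algebra_simps)
  next
    case False
    have "?h (reflection e u) \<le> ?h u + ?h ((- 2 * ?c) *\<^sub>R e)"
      using support_function_add_le[OF P, of u "(- 2 * ?c) *\<^sub>R e"] by (simp add: refl)
    also have "?h ((- 2 * ?c) *\<^sub>R e) = - 2 * ?c * ?h e"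
      using False by (intro support_function_scaleR[OF P]) simp
    finally have "(?h u - ?h (reflection e u)) * ?c \<le> (2 * ?c * ?h e) * ?c"
      using False by (intro mult_right_mono_neg) auto
    then show ?thesis
      by (simp add: power2_eq_square algebra_simps)
  qed
qed

section \<open>Integration over the sphere and positivity of the support function\<close>

lemma integrable_sphere_measure:
  fixes f :: "real ^ 'n::finite \<Rightarrow> 'b::euclidean_space"
  assumes total: "emeasure sphere_measure (UNIV :: (real ^ 'n) set) \<noteq> \<infinity>"
    and cont: "continuous_on UNIV f"
  shows "integrable sphere_measure f"
proof -
  interpret finite_measure "sphere_measure :: (real ^ 'n) measure"
    using total by (intro finite_measureI) simp
  \<comment> \<open>\<open>f\<close> may be unbounded on the whole space, but the measure is
    concentrated on the compact sphere.\<close>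
  have "bounded (f ` sphere 0 1)"
    by (intro compact_imp_bounded compact_continuous_image continuous_on_subset[OF cont]) auto
  then obtain B where "\<And>u. norm u = 1 \<Longrightarrow> norm (f u) \<le> B"
    by (force simp: bounded_iff)
  then have "AE u in sphere_measure. norm (f u) \<le> B"
    by (rule AE_mp[OF AE_sphere_measure AE_I2[OF impI]])
  moreover have "f \<in> borel_measurable sphere_measure"
    using borel_measurable_continuous_onI[OF cont]
    by (simp add: measurable_cong_sets[OF sets_sphere_measure refl])
  ultimately show ?thesis
    by (rule integrable_const_bound)
qed

lemma support_function_pos:
  fixes P :: "(real ^ 'n::finite) set"
  assumes total: "emeasure sphere_measure (UNIV :: (real ^ 'n) set) = 1"
    and P: "bounded P" "interior P \<noteq> {}" and steiner: "steiner_point P = 0"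
    and e: "norm e = 1"
  shows "0 < support_function P e"
proof (rule ccontr)
  let ?h = "support_function P" and ?r = "reflection e"
  let ?\<sigma> = "sphere_measure :: (real ^ 'n) measure"
  let ?g = "\<lambda>u. (?h u - ?h (?r u)) * (u \<bullet> e)"
  assume "\<not> 0 < ?h e"
  then have he: "?h e \<le> 0" by simp
  have P': "P \<noteq> {}"
    using P(2) by auto
  have ee: "e \<bullet> e = 1"
    using e by (simp add: dot_square_norm)
  have orth: "orthogonal_transformation ?r"
    by (rule orthogonal_transformation_reflection)
  have r_e: "?r u \<bullet> e = - (u \<bullet> e)" for u
    by (simp add: reflection_def inner_diff_left ee)
  have cont_h [continuous_intros]: "continuous_on UNIV ?h"
    by (rule continuous_on_support_function[OF P(1) P'])
  have cont_r: "continuous_on UNIV ?r"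
    unfolding reflection_def by (auto intro!: continuous_intros simp: ee)
  have cont_hr: "continuous_on UNIV (\<lambda>u. ?h (?r u))"
    by (rule continuous_on_compose2[OF cont_h cont_r]) auto
  have cont_g: "continuous_on UNIV ?g"
    by (intro continuous_intros cont_hr)
  have int: "integrable ?\<sigma> f" if "continuous_on UNIV f" for f :: "real ^ 'n \<Rightarrow> 'b::euclidean_space"
    using that total by (intro integrable_sphere_measure) simp_all
  have "(\<integral>u. ?h u *\<^sub>R u \<partial>?\<sigma>) = 0"
    using steiner by (simp add: steiner_point_def)
  moreover have "(\<integral>u. (?h u *\<^sub>R u) \<bullet> e \<partial>?\<sigma>) = (\<integral>u. ?h u *\<^sub>R u \<partial>?\<sigma>) \<bullet> e"
    by (intro integral_inner_left int continuous_intros)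
  ultimately have I: "(\<integral>u. ?h u * (u \<bullet> e) \<partial>?\<sigma>) = 0"
    by simp
  \<comment> \<open>The change of variables \<open>?r\<close> preserves the measure and flips the
    sign of \<open>u \<bullet> e\<close>, so the vanishing integral \<open>I\<close> also vanishes
    with \<open>?h (?r u)\<close> in place of \<open>?h u\<close>.\<close>
  have "(\<integral>u. ?h (?r u) * (?r u \<bullet> e) \<partial>?\<sigma>) = (\<integral>u. ?h u * (u \<bullet> e) \<partial>distr ?\<sigma> borel ?r)"
    by (rule integral_distr[symmetric])
      (use borel_measurable_orthogonal[OF orth] in
        \<open>auto simp: measurable_cong_sets[OF sets_sphere_measure refl]
          intro!: borel_measurable_continuous_onI continuous_intros\<close>)
  also have "\<dots> = 0"
    using I by (simp add: distr_sphere_measure_orthogonal[OF orth])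
  finally have "(\<integral>u. ?h (?r u) * (u \<bullet> e) \<partial>?\<sigma>) = 0"
    by (simp add: r_e)
  \<comment> \<open>Negated because a nonnegative integrable function with integral 0 vanishes
    almost everywhere.\<close>
  with I have g0: "(\<integral>u. - ?g u \<partial>?\<sigma>) = 0"
    by (simp add: left_diff_distrib int continuous_intros cont_hr)
  have g_le: "?g u \<le> 0" for u
    using support_function_reflection_le[OF P(1) P' e, of u] he
    by (smt (verit) mult_nonneg_nonpos zero_le_power2)
  have "AE u in ?\<sigma>. - ?g u = 0"
    using g0 g_le by (subst (asm) integral_nonneg_eq_0_iff_AE)
      (auto intro!: int continuous_intros cont_hr)
  then have "AE u in ?\<sigma>. \<not> ?g u < 0"
    by eventually_elim linarith
  moreover have open_U: "open {u. ?g u < 0}"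
    by (intro open_Collect_less cont_g continuous_intros)
  ultimately have "emeasure ?\<sigma> {u. ?g u < 0} = 0"
    by (subst (asm) AE_iff_measurable[of "{u. ?g u < 0}"]) (auto simp: borel_open)
  moreover have "?r e = - e"
    by (simp add: reflection_def ee) (simp add: scaleR_2)
  \<comment> \<open>Since \<open>?h e \<le> 0\<close>, positive width forces
    \<open>?h (- e) > 0\<close>. Thus \<open>e\<close> lies in the open null set just found.\<close>
  then have "?g e < 0"
    using support_function_width_pos[OF P e] he by (simp add: ee)
  ultimately show False
    using emeasure_sphere_measure_open_pos[OF _ open_U _ e] total by simp
qed

section \<open>Polynomials\<close>

text \<open>Each exponent is at most the total degree. Finiteness matters because \<open>sum\<close>
  over an infinite set is 0.\<close>

lemma finite_exponents_le: "finite {\<alpha> :: 'n::finite \<Rightarrow> nat. (\<Sum>i\<in>UNIV. \<alpha> i) \<le> t}"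
proof (rule finite_subset)
  show "{\<alpha> :: 'n \<Rightarrow> nat. (\<Sum>i\<in>UNIV. \<alpha> i) \<le> t} \<subseteq> UNIV \<rightarrow>\<^sub>E {..t}"
    by (auto intro: order_trans[OF member_le_sum[of _ UNIV]])
  show "finite (UNIV \<rightarrow>\<^sub>E {..t} :: ('n \<Rightarrow> nat) set)"
    by (intro finite_PiE) auto
qed

lemma homogeneous_poly_imp_poly_of_degree_le:
  assumes "homogeneous_poly m H" "m \<le> t"
  shows "poly_of_degree_le t H"
proof -
  from assms obtain c where
    H: "H = (\<lambda>x. \<Sum>\<alpha> | (\<Sum>i\<in>UNIV. \<alpha> i) = m. c \<alpha> * monomial_fun \<alpha> x)"
    by (auto simp: homogeneous_poly_def)
  have "H = (\<lambda>x. \<Sum>\<alpha> | (\<Sum>i\<in>UNIV. \<alpha> i) \<le> t.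
      (if (\<Sum>i\<in>UNIV. \<alpha> i) = m then c \<alpha> else 0) * monomial_fun \<alpha> x)"
    unfolding H using \<open>m \<le> t\<close>
    by (intro ext sum.mono_neutral_cong_left finite_exponents_le) auto
  then show ?thesis
    unfolding poly_of_degree_le_def
    by (rule exI[of _ "\<lambda>\<alpha>. if (\<Sum>i\<in>UNIV. \<alpha> i) = m then c \<alpha> else 0"])
qed

lemma homogeneous_poly_monomial_fun:
  assumes "(\<Sum>i\<in>UNIV. \<alpha> i) = m"
  shows "homogeneous_poly m (monomial_fun \<alpha>)"
proof -
  have "finite {\<beta> :: 'a \<Rightarrow> nat. (\<Sum>i\<in>UNIV. \<beta> i) = m}"
    by (rule finite_subset[OF _ finite_exponents_le[of m]]) auto
  then have "monomial_fun \<alpha> x = (\<Sum>\<beta> | (\<Sum>i\<in>UNIV. \<beta> i) = m. of_bool (\<beta> = \<alpha>) * monomial_fun \<beta> x)"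
    for x :: "real ^ 'a"
    using assms by (simp add: of_bool_def if_distrib[of "\<lambda>c. c * _"] cong: if_cong)
  then show ?thesis
    unfolding homogeneous_poly_def by (intro exI[of _ "\<lambda>\<beta>. of_bool (\<beta> = \<alpha>)"] ext)
qed

lemma homogeneous_poly_scaleR:
  assumes "homogeneous_poly m H"
  shows "H (a *\<^sub>R x) = a ^ m * H x"
proof -
  from assms obtain c where
    "H = (\<lambda>x. \<Sum>\<alpha> | (\<Sum>i\<in>UNIV. \<alpha> i) = m. c \<alpha> * monomial_fun \<alpha> x)"
    by (auto simp: homogeneous_poly_def)
  then show ?thesis
    by (auto simp: monomial_fun_def power_mult_distrib prod.distrib sum_distrib_left
        power_sum[symmetric] intro!: sum.cong)
qed

text \<open>Grouping equal letters of the word \<open>I\<close> collects the factors into powers.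
  This reduces the tensor identity, coordinate by coordinate, to the polynomial one.\<close>

lemma tensor_power_eq_monomial_fun:
  fixes I :: "'n::finite list"
  assumes "length I = m"
  shows "(\<lambda>v. tensor_power m v I) = monomial_fun (count_list I)"
proof
  fix v :: "real ^ 'n"
  have "prod_list (map (\<lambda>i. v $ i) I) = (\<Prod>i\<in>UNIV. (v $ i) ^ count_list I i)"
  proof (induction I)
    case (Cons a I)
    have "(\<Prod>i\<in>UNIV. (v $ i) ^ count_list (a # I) i) =
        (\<Prod>i\<in>UNIV. (if a = i then v $ i else 1) * (v $ i) ^ count_list I i)"
      by (intro prod.cong) auto
    then show ?case
      using Cons by (simp add: prod.distrib)
  qed simp
  with assms show "tensor_power m v I = monomial_fun (count_list I) v"
    by (simp add: tensor_power_def monomial_fun_def)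
qed

lemma sum_count_list_UNIV: "(\<Sum>i\<in>UNIV. count_list I i) = length (I :: 'n::finite list)"
  by (rule sum_count_set) auto

section \<open>Normalization of the surface measure and the moment identities\<close>

lemma spherical_design_imp_emeasure_eq_1:
  fixes X :: "(real ^ 'n::finite) set"
  assumes X: "spherical_design t X" "X \<noteq> {}"
  shows "emeasure sphere_measure (UNIV :: (real ^ 'n) set) = 1"
proof -
  \<comment> \<open>The zero exponent vector gives the constant 1, whose average over a nonempty
    \<open>X\<close> is 1.\<close>
  have "poly_of_degree_le t (monomial_fun (\<lambda>_ :: 'n. 0))"
    by (rule homogeneous_poly_imp_poly_of_degree_le[OF homogeneous_poly_monomial_fun]) auto
  then have "poly_of_degree_le t (\<lambda>_ :: real ^ 'n. 1)"
    by (simp add: monomial_fun_def[abs_def])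
  with X have "1 / real (card X) * (\<Sum>x\<in>X. 1) = (\<integral>u. 1 \<partial>(sphere_measure :: (real ^ 'n) measure))"
    unfolding spherical_design_def by blast
  moreover have "0 < card X"
    using X by (auto simp: spherical_design_def card_gt_0_iff)
  ultimately have "measure sphere_measure (UNIV :: (real ^ 'n) set) = 1"
    by simp
  \<comment> \<open>\<open>measure\<close> sends an infinite value to 0, so the value 1 excludes
    it.\<close>
  moreover from this have "emeasure sphere_measure (UNIV :: (real ^ 'n) set) \<noteq> \<infinity>"
    by (auto simp: measure_def)
  ultimately show ?thesis
    by (simp add: emeasure_eq_ennreal_measure)
qed

theorem theorem3p1:
  fixes x :: "nat \<Rightarrow> real ^ 'n::finite" and N t :: nat
    and P :: "(real ^ 'n) set" and h :: "nat \<Rightarrow> real" and v :: "nat \<Rightarrow> real ^ 'n"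
  assumes "CARD('n) \<ge> 2" and "t \<ge> 2"
    and "inj_on x {1..N}"
    and "spherical_design t (x ` {1..N})"
    and "steiner_normalized_minkowski_polytope (x ` {1..N}) P"
    and "\<forall>i\<in>{1..N}. h i = support_function P (x i)"
    and "\<forall>i\<in>{1..N}. v i = (1 / h i) *\<^sub>R x i"
  shows "(\<forall>i\<in>{1..N}. h i > 0) \<and>
    (\<forall>m\<le>t.
      (\<forall>H. homogeneous_poly m H \<longrightarrow>
        1 / real N * (\<Sum>i=1..N. h i ^ m * H (v i)) = (\<integral>u. H u \<partial>sphere_measure)) \<and>
      (\<lambda>I. 1 / real N * (\<Sum>i=1..N. h i ^ m * tensor_power m (v i) I)) = moment_tensor m)"
proof (intro conjI allI impI)
  let ?\<sigma> = "sphere_measure :: (real ^ 'n) measure"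
  have card: "card (x ` {1..N}) = N"
    using assms(3) by (simp add: card_image)
  have P: "bounded P" "interior P \<noteq> {}" "steiner_point P = 0"
    using assms(5) polytope_imp_bounded
    by (auto simp: steiner_normalized_minkowski_polytope_def minkowski_polytope_def)
  have "h i > 0" if i: "i \<in> {1..N}" for i
  proof -
    have "norm (x i) = 1"
      using assms(4) i by (force simp: spherical_design_def)
    \<comment> \<open>The index \<open>i\<close> witnesses that the design is nonempty.\<close>
    moreover have "emeasure ?\<sigma> UNIV = 1"
      using i by (intro spherical_design_imp_emeasure_eq_1[OF assms(4)]) auto
    ultimately show ?thesis
      using support_function_pos P assms(6) i by auto
  qed
  then show h: "\<forall>i\<in>{1..N}. h i > 0"
    by blast
  fix m assume m: "m \<le> t"
  show main: "1 / real N * (\<Sum>i=1..N. h i ^ m * H (v i)) = (\<integral>u. H u \<partial>?\<sigma>)"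
    if H: "homogeneous_poly m H" for H
  proof -
    have "h i ^ m * H (v i) = H (x i)" if i: "i \<in> {1..N}" for i
    proof -
      have "h i > 0" using h i by blast
      then show ?thesis
        using assms(7) i by (simp add: homogeneous_poly_scaleR[OF H] power_divide)
    qed
    \<comment> \<open>Distinctness of the points turns the sum over indices into the sum over the
      set.\<close>
    then have "1 / real N * (\<Sum>i=1..N. h i ^ m * H (v i)) = 1 / real N * (\<Sum>y\<in>x ` {1..N}. H y)"
      by (simp add: sum.reindex[OF assms(3)] del: One_nat_def)
    also have "\<dots> = (\<integral>u. H u \<partial>?\<sigma>)"
      using assms(4) homogeneous_poly_imp_poly_of_degree_le[OF H m]
      unfolding spherical_design_def card by blast
    finally show ?thesis .
  qed
  show "(\<lambda>I. 1 / real N * (\<Sum>i=1..N. h i ^ m * tensor_power m (v i) I)) = moment_tensor m"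
  proof
    fix I :: "'n list"
    show "1 / real N * (\<Sum>i=1..N. h i ^ m * tensor_power m (v i) I) = moment_tensor m I"
    proof (cases "length I = m")
      case True
      have "homogeneous_poly m (\<lambda>w. tensor_power m w I)"
        using True by (simp add: tensor_power_eq_monomial_fun homogeneous_poly_monomial_fun
            sum_count_list_UNIV)
      from main[OF this] show ?thesis
        by (simp add: moment_tensor_def)
    next
      \<comment> \<open>Both sides are 0, as tensors are extended by 0 to words of other
        lengths.\<close>
      case False
      then show ?thesis
        by (simp add: moment_tensor_def tensor_power_def)
    qed
  qed
qed

end
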